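(* Let $\mathbb T$ be the theory of bounded distributive lattices. If an $\mathbb I$-algebra $A$ satisfies the generalised Phoa principle, then so does the polynomial $\mathbb I$-algebra $A[\mathsf j]$.
   Context: We work in intensional type theory with function extensionality. $\mathbb I$ is a bounded distributive lattice; an $\mathbb I$-algebra is a bounded distributive lattice $A$ with a homomorphism $\mathbb I\to A$ (elements of $\mathbb I$ identified with their images). $A[\mathsf j]$ is the free $\mathbb I$-algebra over $A$ on one generator $\mathsf j$ (the polynomial algebra). An $\mathbb I$-algebra $A$ satisfies the generalised Phoa principle if for every function $\alpha:\mathbb I\to A$ and every $i:\mathbb I$, $\alpha(i)=\alpha(0)\vee(i\wedge\alpha(1))$; equivalently, the map $A^{\mathbb I}\to A\times A$, $\alpha\mapsto(\alpha(0),\alpha(1))$, is an embedding with image $\{(a,b)\mid a\le_A b\}$. *)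

theory Defs imports Main begin

text \<open>
  The theorem is a statement of constructive type theory.  Read naively in HOL, with
  \<open>\<alpha>\<close> ranging over all HOL functions from \<open>I\<close> to \<open>A\<close>, the Phoa principle forces \<open>A\<close> to be
  trivial (take \<open>\<alpha> 0 = 1\<close> and \<open>\<alpha> 1 = 0\<close>).  It is therefore stated in the internal language of
  an arbitrary category with finite limits, interpreted in Kripke-Joyal style: a term in
  context \<open>\<Gamma>\<close> of a type interpreted by \<open>X\<close> is a generalised element \<open>\<Gamma> \<rightarrow> X\<close>, a function
  \<open>X \<rightarrow> Y\<close> in context \<open>\<Gamma>\<close> is an arrow \<open>\<Gamma> \<times> X \<rightarrow> Y\<close>, and a universally quantified
  equation holds iff it holds for all generalised elements over all \<open>\<Gamma>\<close>.  Function
  extensionality is built in, as an arrow \<open>\<Gamma> \<times> X \<rightarrow> Y\<close> is determined by its values on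
  generalised elements.  The locally cartesian closed categories, which model dependent type
  theory, are instances.
\<close>

record ('o, 'm) cat =
  Obj :: "'o set"
  Arr :: "'m set"
  Dom :: "'m \<Rightarrow> 'o"
  Cod :: "'m \<Rightarrow> 'o"
  Ident :: "'o \<Rightarrow> 'm"
  Comp :: "'m \<Rightarrow> 'm \<Rightarrow> 'm" (infixr "\<odot>\<index>" 70)

record ('o, 'm) fp_cat = "('o, 'm) cat" +
  One :: "'o"
  Bang :: "'o \<Rightarrow> 'm"
  Prod :: "'o \<Rightarrow> 'o \<Rightarrow> 'o"
  Proj1 :: "'o \<Rightarrow> 'o \<Rightarrow> 'm"
  Proj2 :: "'o \<Rightarrow> 'o \<Rightarrow> 'm"
  Tuple :: "'m \<Rightarrow> 'm \<Rightarrow> 'm"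

definition hom :: "('o, 'm, 'x) cat_scheme \<Rightarrow> 'o \<Rightarrow> 'o \<Rightarrow> 'm set" where
  "hom C X Y = {f \<in> Arr C. Dom C f = X \<and> Cod C f = Y}"

locale category =
  fixes C :: "('o, 'm, 'x) cat_scheme" (structure)
  assumes dom_closed: "f \<in> Arr C \<Longrightarrow> Dom C f \<in> Obj C"
    and cod_closed: "f \<in> Arr C \<Longrightarrow> Cod C f \<in> Obj C"
    and ident_closed: "X \<in> Obj C \<Longrightarrow> Ident C X \<in> hom C X X"
    and comp_closed: "\<lbrakk>f \<in> hom C X Y; g \<in> hom C Y Z\<rbrakk> \<Longrightarrow> g \<odot> f \<in> hom C X Z"
    and comp_assoc:
      "\<lbrakk>f \<in> hom C W X; g \<in> hom C X Y; h \<in> hom C Y Z\<rbrakk> \<Longrightarrow> (h \<odot> g) \<odot> f = h \<odot> (g \<odot> f)"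
    and ident_left: "f \<in> hom C X Y \<Longrightarrow> Ident C Y \<odot> f = f"
    and ident_right: "f \<in> hom C X Y \<Longrightarrow> f \<odot> Ident C X = f"

locale finitely_complete_category = category C
  for C :: "('o, 'm, 'x) fp_cat_scheme" (structure) +
  assumes one_closed: "One C \<in> Obj C"
    and bang_closed: "X \<in> Obj C \<Longrightarrow> Bang C X \<in> hom C X (One C)"
    and bang_unique: "f \<in> hom C X (One C) \<Longrightarrow> f = Bang C X"
    and prod_closed: "\<lbrakk>X \<in> Obj C; Y \<in> Obj C\<rbrakk> \<Longrightarrow> Prod C X Y \<in> Obj C"
    and proj1_closed: "\<lbrakk>X \<in> Obj C; Y \<in> Obj C\<rbrakk> \<Longrightarrow> Proj1 C X Y \<in> hom C (Prod C X Y) X"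
    and proj2_closed: "\<lbrakk>X \<in> Obj C; Y \<in> Obj C\<rbrakk> \<Longrightarrow> Proj2 C X Y \<in> hom C (Prod C X Y) Y"
    and tuple_closed:
      "\<lbrakk>f \<in> hom C Z X; g \<in> hom C Z Y\<rbrakk> \<Longrightarrow> Tuple C f g \<in> hom C Z (Prod C X Y)"
    and proj1_tuple: "\<lbrakk>f \<in> hom C Z X; g \<in> hom C Z Y\<rbrakk> \<Longrightarrow> Proj1 C X Y \<odot> Tuple C f g = f"
    and proj2_tuple: "\<lbrakk>f \<in> hom C Z X; g \<in> hom C Z Y\<rbrakk> \<Longrightarrow> Proj2 C X Y \<odot> Tuple C f g = g"
    and tuple_unique:
      "\<lbrakk>X \<in> Obj C; Y \<in> Obj C; h \<in> hom C Z (Prod C X Y)\<rbrakk>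
        \<Longrightarrow> Tuple C (Proj1 C X Y \<odot> h) (Proj2 C X Y \<odot> h) = h"
    and equalizers:
      "\<lbrakk>f \<in> hom C X Y; g \<in> hom C X Y\<rbrakk>
        \<Longrightarrow> \<exists>E. \<exists>e \<in> hom C E X. f \<odot> e = g \<odot> e \<and>
              (\<forall>Z. \<forall>h \<in> hom C Z X. f \<odot> h = g \<odot> h \<longrightarrow> (\<exists>!u. u \<in> hom C Z E \<and> e \<odot> u = h))"

record ('o, 'm) lattice_object =
  Carrier :: "'o"
  Bot :: "'m"
  Top :: "'m"
  Meet :: "'m"
  Join :: "'m"

text \<open>The constants and operations on generalised elements over a context \<open>\<Gamma>\<close>.\<close>

definition bot_at :: "('o, 'm, 'x) fp_cat_scheme \<Rightarrow> ('o, 'm, 'y) lattice_object_scheme \<Rightarrow> 'o \<Rightarrow> 'm"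
  where "bot_at C L \<Gamma> = Bot L \<odot>\<^bsub>C\<^esub> Bang C \<Gamma>"

definition top_at :: "('o, 'm, 'x) fp_cat_scheme \<Rightarrow> ('o, 'm, 'y) lattice_object_scheme \<Rightarrow> 'o \<Rightarrow> 'm"
  where "top_at C L \<Gamma> = Top L \<odot>\<^bsub>C\<^esub> Bang C \<Gamma>"

definition meet_of ::
    "('o, 'm, 'x) fp_cat_scheme \<Rightarrow> ('o, 'm, 'y) lattice_object_scheme \<Rightarrow> 'm \<Rightarrow> 'm \<Rightarrow> 'm"
  where "meet_of C L x y = Meet L \<odot>\<^bsub>C\<^esub> Tuple C x y"

definition join_of ::
    "('o, 'm, 'x) fp_cat_scheme \<Rightarrow> ('o, 'm, 'y) lattice_object_scheme \<Rightarrow> 'm \<Rightarrow> 'm \<Rightarrow> 'm"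
  where "join_of C L x y = Join L \<odot>\<^bsub>C\<^esub> Tuple C x y"

definition bounded_distrib_lattice ::
    "('o, 'm, 'x) fp_cat_scheme \<Rightarrow> ('o, 'm, 'y) lattice_object_scheme \<Rightarrow> bool" where
  "bounded_distrib_lattice C L \<longleftrightarrow>
     Carrier L \<in> Obj C \<and>
     Bot L \<in> hom C (One C) (Carrier L) \<and>
     Top L \<in> hom C (One C) (Carrier L) \<and>
     Meet L \<in> hom C (Prod C (Carrier L) (Carrier L)) (Carrier L) \<and>
     Join L \<in> hom C (Prod C (Carrier L) (Carrier L)) (Carrier L) \<and>
     (\<forall>\<Gamma> \<in> Obj C. \<forall>x \<in> hom C \<Gamma> (Carrier L). \<forall>y \<in> hom C \<Gamma> (Carrier L). \<forall>z \<in> hom C \<Gamma> (Carrier L).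
        meet_of C L (meet_of C L x y) z = meet_of C L x (meet_of C L y z) \<and>
        join_of C L (join_of C L x y) z = join_of C L x (join_of C L y z) \<and>
        meet_of C L x y = meet_of C L y x \<and>
        join_of C L x y = join_of C L y x \<and>
        meet_of C L x (join_of C L x y) = x \<and>
        join_of C L x (meet_of C L x y) = x \<and>
        meet_of C L x (join_of C L y z) = join_of C L (meet_of C L x y) (meet_of C L x z) \<and>
        join_of C L x (bot_at C L \<Gamma>) = x \<and>
        meet_of C L x (top_at C L \<Gamma>) = x)"

definition lattice_hom ::
    "('o, 'm, 'x) fp_cat_scheme \<Rightarrow> ('o, 'm, 'y) lattice_object_scheme \<Rightarrow>
     ('o, 'm, 'z) lattice_object_scheme \<Rightarrow> 'm \<Rightarrow> bool" where
  "lattice_hom C L M f \<longleftrightarrow>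
     f \<in> hom C (Carrier L) (Carrier M) \<and>
     f \<odot>\<^bsub>C\<^esub> Bot L = Bot M \<and>
     f \<odot>\<^bsub>C\<^esub> Top L = Top M \<and>
     (\<forall>\<Gamma> \<in> Obj C. \<forall>x \<in> hom C \<Gamma> (Carrier L). \<forall>y \<in> hom C \<Gamma> (Carrier L).
        f \<odot>\<^bsub>C\<^esub> meet_of C L x y = meet_of C M (f \<odot>\<^bsub>C\<^esub> x) (f \<odot>\<^bsub>C\<^esub> y) \<and>
        f \<odot>\<^bsub>C\<^esub> join_of C L x y = join_of C M (f \<odot>\<^bsub>C\<^esub> x) (f \<odot>\<^bsub>C\<^esub> y))"

text \<open>\<open>Struct A\<close> is the structure map \<open>I \<rightarrow> A\<close> of an \<open>I\<close>-algebra.\<close>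

record ('o, 'm) algebra_object = "('o, 'm) lattice_object" +
  Struct :: "'m"

definition I_algebra ::
    "('o, 'm, 'x) fp_cat_scheme \<Rightarrow> ('o, 'm) lattice_object \<Rightarrow> ('o, 'm) algebra_object \<Rightarrow> bool" where
  "I_algebra C I A \<longleftrightarrow> bounded_distrib_lattice C A \<and> lattice_hom C I A (Struct A)"

definition I_algebra_hom ::
    "('o, 'm, 'x) fp_cat_scheme \<Rightarrow> ('o, 'm) algebra_object \<Rightarrow> ('o, 'm) algebra_object \<Rightarrow> 'm \<Rightarrow> bool"
  where "I_algebra_hom C A B f \<longleftrightarrow> lattice_hom C A B f \<and> f \<odot>\<^bsub>C\<^esub> Struct A = Struct B"

text \<open>
  \<open>P\<close>, with \<open>\<iota> : A \<rightarrow> P\<close> and the element \<open>j\<close> of \<open>P\<close>, is the free \<open>I\<close>-algebra over \<open>A\<close> on one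
  generator.  The universal property is required only in the empty context; when \<open>C\<close> is locally
  cartesian closed this already gives it in every context, since the pullback functors to the
  slices then have right adjoints, which preserve algebras.
\<close>

definition polynomial_algebra ::
    "('o, 'm, 'x) fp_cat_scheme \<Rightarrow> ('o, 'm) lattice_object \<Rightarrow> ('o, 'm) algebra_object \<Rightarrow>
     ('o, 'm) algebra_object \<Rightarrow> 'm \<Rightarrow> 'm \<Rightarrow> bool" where
  "polynomial_algebra C I A P \<iota> j \<longleftrightarrow>
     I_algebra C I P \<and> I_algebra_hom C A P \<iota> \<and> j \<in> hom C (One C) (Carrier P) \<and>
     (\<forall>B f b. I_algebra C I B \<and> I_algebra_hom C A B f \<and> b \<in> hom C (One C) (Carrier B) \<longrightarrow>
        (\<exists>!h. I_algebra_hom C P B h \<and> h \<odot>\<^bsub>C\<^esub> \<iota> = f \<and> h \<odot>\<^bsub>C\<^esub> j = b))"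

text \<open>
  The value at \<open>i : \<Gamma> \<rightarrow> I\<close> of the function \<open>I \<rightarrow> A\<close> in context \<open>\<Gamma>\<close> given by
  \<open>\<alpha> : \<Gamma> \<times> I \<rightarrow> A\<close>.
\<close>

definition app :: "('o, 'm, 'x) fp_cat_scheme \<Rightarrow> 'o \<Rightarrow> 'm \<Rightarrow> 'm \<Rightarrow> 'm" where
  "app C \<Gamma> \<alpha> i = \<alpha> \<odot>\<^bsub>C\<^esub> Tuple C (Ident C \<Gamma>) i"

definition generalised_Phoa ::
    "('o, 'm, 'x) fp_cat_scheme \<Rightarrow> ('o, 'm) lattice_object \<Rightarrow> ('o, 'm) algebra_object \<Rightarrow> bool" where
  "generalised_Phoa C I A \<longleftrightarrow>
     (\<forall>\<Gamma> \<in> Obj C. \<forall>\<alpha> \<in> hom C (Prod C \<Gamma> (Carrier I)) (Carrier A). \<forall>i \<in> hom C \<Gamma> (Carrier I).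
        app C \<Gamma> \<alpha> i =
          join_of C A (app C \<Gamma> \<alpha> (bot_at C I \<Gamma>))
            (meet_of C A (Struct A \<odot>\<^bsub>C\<^esub> i) (app C \<Gamma> \<alpha> (top_at C I \<Gamma>))))"

end

theory Submission imports Defs begin

text \<open>
  Evaluation at \<open>j = 0\<close> and \<open>j = 1\<close> gives homomorphisms \<open>h\<^sub>0, h\<^sub>1 : A[j] \<rightarrow> A\<close>.  The elements \<open>p\<close>
  with \<open>h\<^sub>0 p \<le> h\<^sub>1 p\<close> form a subalgebra containing \<open>A\<close> and \<open>j\<close>, hence everything.  Therefore
  \<open>p \<mapsto> h\<^sub>0 p \<or> (j \<and> h\<^sub>1 p)\<close> is an endomorphism of \<open>A[j]\<close> fixing \<open>A\<close> and \<open>j\<close>, hence the identity.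
  So \<open>h\<^sub>0\<close> and \<open>h\<^sub>1\<close> are jointly injective, and the Phoa equation can be checked after applying
  them, where it is the one for \<open>A\<close>.
\<close>

section \<open>Elementary algebra of bounded distributive lattices on a carrier set\<close>

text \<open>The carrier is a set and not a whole type because the intended instances are the
  hom-sets \<open>hom C \<Gamma> (Carrier L)\<close>: the generalised elements of a lattice object
  over one context, with operations shared by all contexts.\<close>

locale bounded_distrib_lattice_on =
  fixes S :: "'a set"
    and bot top :: 'a
    and meet :: "'a \<Rightarrow> 'a \<Rightarrow> 'a" (infixl "\<sqinter>" 70)
    and join :: "'a \<Rightarrow> 'a \<Rightarrow> 'a" (infixl "\<squnion>" 65)
  assumes bot_closed [simp]: "bot \<in> S"
    and top_closed [simp]: "top \<in> S"
    and meet_closed [simp]: "\<lbrakk>x \<in> S; y \<in> S\<rbrakk> \<Longrightarrow> x \<sqinter> y \<in> S"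
    and join_closed [simp]: "\<lbrakk>x \<in> S; y \<in> S\<rbrakk> \<Longrightarrow> x \<squnion> y \<in> S"
    and meet_assoc: "\<lbrakk>x \<in> S; y \<in> S; z \<in> S\<rbrakk> \<Longrightarrow> x \<sqinter> y \<sqinter> z = x \<sqinter> (y \<sqinter> z)"
    and join_assoc: "\<lbrakk>x \<in> S; y \<in> S; z \<in> S\<rbrakk> \<Longrightarrow> x \<squnion> y \<squnion> z = x \<squnion> (y \<squnion> z)"
    and meet_commute: "\<lbrakk>x \<in> S; y \<in> S\<rbrakk> \<Longrightarrow> x \<sqinter> y = y \<sqinter> x"
    and join_commute: "\<lbrakk>x \<in> S; y \<in> S\<rbrakk> \<Longrightarrow> x \<squnion> y = y \<squnion> x"
    and meet_join_absorb [simp]: "\<lbrakk>x \<in> S; y \<in> S\<rbrakk> \<Longrightarrow> x \<sqinter> (x \<squnion> y) = x"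
    and join_meet_absorb [simp]: "\<lbrakk>x \<in> S; y \<in> S\<rbrakk> \<Longrightarrow> x \<squnion> x \<sqinter> y = x"
    and meet_join_distrib:
      "\<lbrakk>x \<in> S; y \<in> S; z \<in> S\<rbrakk> \<Longrightarrow> x \<sqinter> (y \<squnion> z) = x \<sqinter> y \<squnion> x \<sqinter> z"
    and join_bot [simp]: "x \<in> S \<Longrightarrow> x \<squnion> bot = x"
    and meet_top [simp]: "x \<in> S \<Longrightarrow> x \<sqinter> top = x"
begin

lemma meet_left_commute: "\<lbrakk>x \<in> S; y \<in> S; z \<in> S\<rbrakk> \<Longrightarrow> x \<sqinter> (y \<sqinter> z) = y \<sqinter> (x \<sqinter> z)"
  by (metis meet_assoc meet_commute)

lemma join_left_commute: "\<lbrakk>x \<in> S; y \<in> S; z \<in> S\<rbrakk> \<Longrightarrow> x \<squnion> (y \<squnion> z) = y \<squnion> (x \<squnion> z)"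
  by (metis join_assoc join_commute)

lemmas meet_ac = meet_assoc meet_commute meet_left_commute
lemmas join_ac = join_assoc join_commute join_left_commute

lemma meet_idem [simp]: "x \<in> S \<Longrightarrow> x \<sqinter> x = x"
  by (metis bot_closed join_bot meet_join_absorb)

text \<open>The dual distributive law is derived, only one of the two being an axiom: after
  expanding, \<open>z\<close> absorbs both mixed terms.\<close>

lemma join_meet_distrib:
  assumes "x \<in> S" "y \<in> S" "z \<in> S"
  shows "(x \<squnion> z) \<sqinter> (y \<squnion> z) = x \<sqinter> y \<squnion> z"
proof -
  have "(x \<squnion> z) \<sqinter> (y \<squnion> z) = (x \<squnion> z) \<sqinter> y \<squnion> (x \<squnion> z) \<sqinter> z"
    using assms by (simp add: meet_join_distrib)
  also have "(x \<squnion> z) \<sqinter> z = z"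
    using assms by (metis join_closed join_commute meet_commute meet_join_absorb)
  also have "(x \<squnion> z) \<sqinter> y = x \<sqinter> y \<squnion> z \<sqinter> y"
    using assms by (metis join_closed meet_commute meet_join_distrib)
  also have "x \<sqinter> y \<squnion> z \<sqinter> y \<squnion> z = x \<sqinter> y \<squnion> z"
    using assms by (metis join_assoc join_commute join_meet_absorb meet_closed)
  finally show ?thesis .
qed

lemma bot_meet [simp]: "x \<in> S \<Longrightarrow> bot \<sqinter> x = bot"
  by (metis bot_closed join_bot join_commute meet_join_absorb)

lemma bot_join [simp]: "x \<in> S \<Longrightarrow> bot \<squnion> x = x"
  by (metis bot_closed join_bot join_commute)

lemma top_join [simp]: "x \<in> S \<Longrightarrow> top \<squnion> x = top"
  by (metis join_meet_absorb meet_commute meet_top top_closed)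

text \<open>The order is always expressed by the equation \<open>x \<sqinter> y = x\<close>, a form
  that an equalizer can carve out. Together with \<open>join_mono\<close> this shows that the
  elements on which one homomorphism lies below another are closed under the operations.\<close>

lemma meet_mono:
  assumes "x \<in> S" "y \<in> S" "x' \<in> S" "y' \<in> S" "x \<sqinter> y = x" "x' \<sqinter> y' = x'"
  shows "(x \<sqinter> x') \<sqinter> (y \<sqinter> y') = x \<sqinter> x'"
  using assms by (metis meet_assoc meet_closed meet_commute)

lemma join_mono:
  assumes "x \<in> S" "y \<in> S" "x' \<in> S" "y' \<in> S" "x \<sqinter> y = x" "x' \<sqinter> y' = x'"
  shows "(x \<squnion> x') \<sqinter> (y \<squnion> y') = x \<squnion> x'"
proof -
  \<comment> \<open>The dual description of the order turns monotonicity of the join into a mere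
    rearrangement of joins; absorption then leads back to the form with meets.\<close>
  have *: "x \<squnion> y = y" if "x \<in> S" "y \<in> S" "x \<sqinter> y = x" for x y
    using that by (metis join_commute join_meet_absorb meet_commute)
  have "y \<squnion> y' = (x \<squnion> x') \<squnion> (y \<squnion> y')"
  proof -
    have "y \<squnion> y' = (x \<squnion> y) \<squnion> (x' \<squnion> y')"
      using * assms by simp
    then show ?thesis
      using assms(1-4) by (simp add: join_ac)
  qed
  then show ?thesis
    using assms(1-4) by (metis join_closed meet_join_absorb)
qed

lemma interpolation_join:
  assumes "x \<in> S" "y \<in> S" "x' \<in> S" "y' \<in> S" "j \<in> S"
  shows "(x \<squnion> x') \<squnion> j \<sqinter> (y \<squnion> y') = (x \<squnion> j \<sqinter> y) \<squnion> (x' \<squnion> j \<sqinter> y')"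
  using assms by (simp add: meet_join_distrib join_ac)

text \<open>For \<open>x\<close> below \<open>y\<close>, the interpolant
  \<open>x \<squnion> j \<sqinter> y\<close> can be rewritten as
  \<open>(x \<squnion> j) \<sqinter> y\<close>. In this form the meet of two interpolants can be
  regrouped, and the dual distributive law merges the two factors containing
  \<open>j\<close>.\<close>

lemma interpolation_meet:
  assumes "x \<in> S" "y \<in> S" "x' \<in> S" "y' \<in> S" "j \<in> S" "x \<sqinter> y = x" "x' \<sqinter> y' = x'"
  shows "x \<sqinter> x' \<squnion> j \<sqinter> (y \<sqinter> y') = (x \<squnion> j \<sqinter> y) \<sqinter> (x' \<squnion> j \<sqinter> y')"
proof -
  have *: "x \<squnion> j \<sqinter> y = (x \<squnion> j) \<sqinter> y" if "x \<in> S" "y \<in> S" "x \<sqinter> y = x" for x y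
    using that \<open>j \<in> S\<close> by (metis join_closed meet_commute meet_join_distrib)
  have "(x \<squnion> j \<sqinter> y) \<sqinter> (x' \<squnion> j \<sqinter> y') = ((x \<squnion> j) \<sqinter> y) \<sqinter> ((x' \<squnion> j) \<sqinter> y')"
    using * assms by simp
  also have "\<dots> = ((x \<squnion> j) \<sqinter> (x' \<squnion> j)) \<sqinter> (y \<sqinter> y')"
    using assms(1-5) by (simp add: meet_ac)
  also have "\<dots> = (x \<sqinter> x' \<squnion> j) \<sqinter> (y \<sqinter> y')"
    using assms by (simp add: join_meet_distrib)
  also have "\<dots> = x \<sqinter> x' \<squnion> j \<sqinter> (y \<sqinter> y')"
    \<comment> \<open>The rewriting \<open>*\<close> is used backwards, at the pair of meets;
      \<open>meet_mono\<close> provides the order between them.\<close>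
    using assms by (simp add: * meet_mono)
  finally show ?thesis ..
qed

end

section \<open>Composition, pairing and terminal arrows\<close>

context category
begin

lemma hom_dom: "f \<in> hom C X Y \<Longrightarrow> X \<in> Obj C"
  using dom_closed by (auto simp: hom_def)

lemma hom_cod: "f \<in> hom C X Y \<Longrightarrow> Y \<in> Obj C"
  using cod_closed by (auto simp: hom_def)

end

context finitely_complete_category
begin

lemma tuple_comp:
  assumes "f \<in> hom C Y X" "g \<in> hom C Y X'" "u \<in> hom C Z Y"
  shows "Tuple C f g \<odot> u = Tuple C (f \<odot> u) (g \<odot> u)"
proof -
  have X: "X \<in> Obj C" "X' \<in> Obj C"
    using assms hom_cod by auto
  have t: "Tuple C f g \<in> hom C Y (Prod C X X')"
    using assms tuple_closed by auto
  have "Tuple C (Proj1 C X X' \<odot> (Tuple C f g \<odot> u)) (Proj2 C X X' \<odot> (Tuple C f g \<odot> u))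
      = Tuple C f g \<odot> u"
    by (rule tuple_unique[OF X comp_closed[OF assms(3) t]])
  then show ?thesis
    using comp_assoc[OF assms(3) t proj1_closed[OF X]] comp_assoc[OF assms(3) t proj2_closed[OF X]]
    by (simp add: proj1_tuple[OF assms(1,2)] proj2_tuple[OF assms(1,2)])
qed

lemma bang_comp:
  assumes "u \<in> hom C Z Y"
  shows "Bang C Y \<odot> u = Bang C Z"
  by (rule bang_unique) (meson assms bang_closed comp_closed hom_cod)

lemma bang_one: "Bang C (One C) = Ident C (One C)"
  by (metis bang_unique ident_closed one_closed)

section \<open>Lattice objects and their generalised elements\<close>

lemma bdl_closed:
  assumes "bounded_distrib_lattice C L"
  shows "Carrier L \<in> Obj C" "Bot L \<in> hom C (One C) (Carrier L)" "Top L \<in> hom C (One C) (Carrier L)"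
    "Meet L \<in> hom C (Prod C (Carrier L) (Carrier L)) (Carrier L)"
    "Join L \<in> hom C (Prod C (Carrier L) (Carrier L)) (Carrier L)"
  using assms by (auto simp: bounded_distrib_lattice_def)

text \<open>The bridge from internal to ordinary algebra: interpreting the locale at a context makes
  every lattice identity proved above available for generalised elements over that context.\<close>

lemma points_lattice:
  assumes L: "bounded_distrib_lattice C L" and "\<Gamma> \<in> Obj C"
  shows "bounded_distrib_lattice_on (hom C \<Gamma> (Carrier L)) (bot_at C L \<Gamma>) (top_at C L \<Gamma>)
    (meet_of C L) (join_of C L)"
proof -
  note c = bdl_closed[OF L]
  have "bot_at C L \<Gamma> \<in> hom C \<Gamma> (Carrier L)" "top_at C L \<Gamma> \<in> hom C \<Gamma> (Carrier L)"
    using c bang_closed[OF \<open>\<Gamma> \<in> Obj C\<close>] unfolding bot_at_def top_at_def by (blast intro: comp_closed)+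
  moreover have "meet_of C L x y \<in> hom C \<Gamma> (Carrier L)" "join_of C L x y \<in> hom C \<Gamma> (Carrier L)"
    if "x \<in> hom C \<Gamma> (Carrier L)" "y \<in> hom C \<Gamma> (Carrier L)" for x y
    using c that unfolding meet_of_def join_of_def by (blast intro: comp_closed tuple_closed)+
  ultimately show ?thesis
    using assms unfolding bounded_distrib_lattice_def by unfold_locales blast+
qed

text \<open>The operations act by composition with a fixed arrow on the left, so they commute with a
  change of context, which is composition on the right. This allows facts about a generic element to
  be transported to all elements.\<close>

lemma op_comp:
  assumes L: "bounded_distrib_lattice C L"
    and x: "x \<in> hom C \<Gamma> (Carrier L)" and y: "y \<in> hom C \<Gamma> (Carrier L)" and u: "u \<in> hom C \<Delta> \<Gamma>"
  shows meet_of_comp: "meet_of C L x y \<odot> u = meet_of C L (x \<odot> u) (y \<odot> u)"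
    and join_of_comp: "join_of C L x y \<odot> u = join_of C L (x \<odot> u) (y \<odot> u)"
  using comp_assoc[OF u tuple_closed[OF x y] bdl_closed(4)[OF L]]
    comp_assoc[OF u tuple_closed[OF x y] bdl_closed(5)[OF L]]
  by (simp_all add: meet_of_def join_of_def tuple_comp[OF x y u])

text \<open>The constants of a lattice object are arrows out of \<open>One C\<close>; they agree
  with the bounds of the lattice of elements over \<open>One C\<close>, since
  \<open>Bang C (One C)\<close> is the identity.\<close>

lemma bound_one:
  assumes L: "bounded_distrib_lattice C L"
  shows bot_at_one: "bot_at C L (One C) = Bot L"
    and top_at_one: "top_at C L (One C) = Top L"
  using ident_right[OF bdl_closed(2)[OF L]] ident_right[OF bdl_closed(3)[OF L]]
  by (simp_all add: bot_at_def top_at_def bang_one)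

section \<open>Homomorphisms of lattices and of algebras\<close>

lemma lattice_hom_closed: "lattice_hom C L M f \<Longrightarrow> f \<in> hom C (Carrier L) (Carrier M)"
  by (simp add: lattice_hom_def)

lemma lattice_hom_op:
  assumes f: "lattice_hom C L M f"
    and x: "x \<in> hom C \<Gamma> (Carrier L)" and y: "y \<in> hom C \<Gamma> (Carrier L)"
  shows lattice_hom_meet: "f \<odot> meet_of C L x y = meet_of C M (f \<odot> x) (f \<odot> y)"
    and lattice_hom_join: "f \<odot> join_of C L x y = join_of C M (f \<odot> x) (f \<odot> y)"
  using assms hom_dom[OF x] unfolding lattice_hom_def by blast+

lemma lattice_hom_ident:
  assumes L: "bounded_distrib_lattice C L"
  shows "lattice_hom C L L (Ident C (Carrier L))"
  unfolding lattice_hom_def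
proof (intro conjI ballI)
  fix \<Gamma> x y
  assume \<Gamma>: "\<Gamma> \<in> Obj C" and xy: "x \<in> hom C \<Gamma> (Carrier L)" "y \<in> hom C \<Gamma> (Carrier L)"
  interpret L: bounded_distrib_lattice_on "hom C \<Gamma> (Carrier L)" "bot_at C L \<Gamma>" "top_at C L \<Gamma>"
    "meet_of C L" "join_of C L"
    by (rule points_lattice[OF L \<Gamma>])
  show "Ident C (Carrier L) \<odot> meet_of C L x y
      = meet_of C L (Ident C (Carrier L) \<odot> x) (Ident C (Carrier L) \<odot> y)"
    using xy by (simp add: ident_left[where X = \<Gamma>])
  show "Ident C (Carrier L) \<odot> join_of C L x y
      = join_of C L (Ident C (Carrier L) \<odot> x) (Ident C (Carrier L) \<odot> y)"
    using xy by (simp add: ident_left[where X = \<Gamma>])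
qed (use bdl_closed[OF L] ident_closed ident_left in blast)+

lemma lattice_hom_comp:
  assumes f: "lattice_hom C L M f" and g: "lattice_hom C M N g" and L: "bounded_distrib_lattice C L"
  shows "lattice_hom C L N (g \<odot> f)"
proof -
  note fc = lattice_hom_closed[OF f] and gc = lattice_hom_closed[OF g]
  note c = bdl_closed[OF L]
  have a: "(g \<odot> f) \<odot> x = g \<odot> (f \<odot> x)" if "x \<in> hom C \<Gamma> (Carrier L)" for \<Gamma> x
    by (rule comp_assoc[OF that fc gc])
  have fx: "f \<odot> x \<in> hom C \<Gamma> (Carrier M)" if "x \<in> hom C \<Gamma> (Carrier L)" for \<Gamma> x
    using that fc comp_closed by blast
  have "(g \<odot> f) \<odot> Bot L = Bot N" "(g \<odot> f) \<odot> Top L = Top N"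
    using f g c a by (auto simp: lattice_hom_def)
  moreover have "(g \<odot> f) \<odot> meet_of C L x y = meet_of C N ((g \<odot> f) \<odot> x) ((g \<odot> f) \<odot> y)"
    "(g \<odot> f) \<odot> join_of C L x y = join_of C N ((g \<odot> f) \<odot> x) ((g \<odot> f) \<odot> y)"
    if "\<Gamma> \<in> Obj C" "x \<in> hom C \<Gamma> (Carrier L)" "y \<in> hom C \<Gamma> (Carrier L)" for \<Gamma> x y
  proof -
    interpret L: bounded_distrib_lattice_on "hom C \<Gamma> (Carrier L)" "bot_at C L \<Gamma>" "top_at C L \<Gamma>"
      "meet_of C L" "join_of C L"
      by (rule points_lattice[OF L that(1)])
    note xy = that(2,3)
    note r = lattice_hom_op[OF f xy] lattice_hom_op[OF g fx fx, OF xy] a[OF xy(1)] a[OF xy(2)]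
    show "(g \<odot> f) \<odot> meet_of C L x y = meet_of C N ((g \<odot> f) \<odot> x) ((g \<odot> f) \<odot> y)"
      by (simp add: r a[OF L.meet_closed[OF xy]])
    show "(g \<odot> f) \<odot> join_of C L x y = join_of C N ((g \<odot> f) \<odot> x) ((g \<odot> f) \<odot> y)"
      by (simp add: r a[OF L.join_closed[OF xy]])
  qed
  ultimately show ?thesis
    using comp_closed[OF fc gc] by (auto simp: lattice_hom_def)
qed

lemma I_algebra_hom_ident:
  assumes "I_algebra C I A"
  shows "I_algebra_hom C A A (Ident C (Carrier A))"
  using assms ident_left lattice_hom_closed lattice_hom_ident
  unfolding I_algebra_def I_algebra_hom_def by blast

lemma I_algebra_hom_comp:
  assumes A: "I_algebra C I A" and f: "I_algebra_hom C A B f" and g: "I_algebra_hom C B D g"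
  shows "I_algebra_hom C A D (g \<odot> f)"
proof -
  have "(g \<odot> f) \<odot> Struct A = g \<odot> (f \<odot> Struct A)"
    using A f g unfolding I_algebra_def I_algebra_hom_def
    by (meson comp_assoc lattice_hom_closed)
  then show ?thesis
    using A f g lattice_hom_comp unfolding I_algebra_def I_algebra_hom_def by metis
qed

section \<open>Subalgebras cut out by an inequality between homomorphisms\<close>

text \<open>A monomorphism compatible with the operations reflects equations: each law for
  \<open>S\<close> becomes, after applying \<open>e\<close>, the same law for \<open>P\<close>.
  Compatibility with meet and join is demanded only at the two projections, the generic pair of
  elements of \<open>S\<close>.\<close>

lemma subalgebra:
  assumes I: "bounded_distrib_lattice C I" and P: "I_algebra C I P"
    and e: "e \<in> hom C (Carrier S) (Carrier P)"
    and mono: "\<And>\<Gamma> x y. \<lbrakk>x \<in> hom C \<Gamma> (Carrier S); y \<in> hom C \<Gamma> (Carrier S); e \<odot> x = e \<odot> y\<rbrakk> \<Longrightarrow> x = y"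
    and S: "Bot S \<in> hom C (One C) (Carrier S)" "Top S \<in> hom C (One C) (Carrier S)"
      "Meet S \<in> hom C (Prod C (Carrier S) (Carrier S)) (Carrier S)"
      "Join S \<in> hom C (Prod C (Carrier S) (Carrier S)) (Carrier S)"
      "Struct S \<in> hom C (Carrier I) (Carrier S)"
    and eBot: "e \<odot> Bot S = Bot P" and eTop: "e \<odot> Top S = Top P"
    and eMeet: "e \<odot> Meet S = meet_of C P (e \<odot> Proj1 C (Carrier S) (Carrier S))
                                        (e \<odot> Proj2 C (Carrier S) (Carrier S))"
    and eJoin: "e \<odot> Join S = join_of C P (e \<odot> Proj1 C (Carrier S) (Carrier S))
                                        (e \<odot> Proj2 C (Carrier S) (Carrier S))"
    and eStruct: "e \<odot> Struct S = Struct P"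
  shows "I_algebra C I S" "I_algebra_hom C S P e"
proof -
  have PL: "bounded_distrib_lattice C P" and Ph: "lattice_hom C I P (Struct P)"
    using P by (auto simp: I_algebra_def)
  have SO: "Carrier S \<in> Obj C"
    using e hom_dom by blast
  note p1 = proj1_closed[OF SO SO] and p2 = proj2_closed[OF SO SO]
  have ex: "e \<odot> x \<in> hom C \<Gamma> (Carrier P)" if "x \<in> hom C \<Gamma> (Carrier S)" for \<Gamma> x
    using that e comp_closed by blast
  \<comment> \<open>An arbitrary pair arises from the generic one by substituting
    \<open>Tuple C x y\<close>.\<close>
  have emeet: "e \<odot> meet_of C S x y = meet_of C P (e \<odot> x) (e \<odot> y)"
    and ejoin: "e \<odot> join_of C S x y = join_of C P (e \<odot> x) (e \<odot> y)"
    if x: "x \<in> hom C \<Gamma> (Carrier S)" and y: "y \<in> hom C \<Gamma> (Carrier S)" for \<Gamma> x y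
  proof -
    note t = tuple_closed[OF x y]
    have q: "(e \<odot> Proj1 C (Carrier S) (Carrier S)) \<odot> Tuple C x y = e \<odot> x"
      "(e \<odot> Proj2 C (Carrier S) (Carrier S)) \<odot> Tuple C x y = e \<odot> y"
      using comp_assoc[OF t p1 e] comp_assoc[OF t p2 e] proj1_tuple[OF x y] proj2_tuple[OF x y]
      by auto
    show "e \<odot> meet_of C S x y = meet_of C P (e \<odot> x) (e \<odot> y)"
      using comp_assoc[OF t S(3) e] meet_of_comp[OF PL ex[OF p1] ex[OF p2] t] q
      by (simp add: meet_of_def[of C S] eMeet)
    show "e \<odot> join_of C S x y = join_of C P (e \<odot> x) (e \<odot> y)"
      using comp_assoc[OF t S(4) e] join_of_comp[OF PL ex[OF p1] ex[OF p2] t] q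
      by (simp add: join_of_def[of C S] eJoin)
  qed
  have ebot: "e \<odot> bot_at C S \<Gamma> = bot_at C P \<Gamma>" and etop: "e \<odot> top_at C S \<Gamma> = top_at C P \<Gamma>"
    if "\<Gamma> \<in> Obj C" for \<Gamma>
    using comp_assoc[OF bang_closed[OF that] S(1) e] comp_assoc[OF bang_closed[OF that] S(2) e]
    by (simp_all add: bot_at_def top_at_def eBot eTop)
  have pts: "bounded_distrib_lattice_on (hom C \<Gamma> (Carrier S)) (bot_at C S \<Gamma>) (top_at C S \<Gamma>)
    (meet_of C S) (join_of C S)" if \<Gamma>: "\<Gamma> \<in> Obj C" for \<Gamma>
  proof -
    interpret P: bounded_distrib_lattice_on "hom C \<Gamma> (Carrier P)" "bot_at C P \<Gamma>" "top_at C P \<Gamma>"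
      "meet_of C P" "join_of C P"
      by (rule points_lattice[OF PL \<Gamma>])
    have cl: "bot_at C S \<Gamma> \<in> hom C \<Gamma> (Carrier S)" "top_at C S \<Gamma> \<in> hom C \<Gamma> (Carrier S)"
      using S bang_closed[OF \<Gamma>] unfolding bot_at_def top_at_def by (blast intro: comp_closed)+
    have cl2: "meet_of C S x y \<in> hom C \<Gamma> (Carrier S)" "join_of C S x y \<in> hom C \<Gamma> (Carrier S)"
      if "x \<in> hom C \<Gamma> (Carrier S)" "y \<in> hom C \<Gamma> (Carrier S)" for x y
      using that S unfolding meet_of_def join_of_def by (blast intro: comp_closed tuple_closed)+
    \<comment> \<open>These rules push \<open>e\<close> inwards to the variables, which turns each
      axiom below into an instance in \<open>P\<close>.\<close>
    note r = cl cl2 emeet[where \<Gamma> = \<Gamma>] ejoin[where \<Gamma> = \<Gamma>] ebot[OF \<Gamma>] etop[OF \<Gamma>] ex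
    show ?thesis
    proof
      fix x y z
      assume xyz: "x \<in> hom C \<Gamma> (Carrier S)" "y \<in> hom C \<Gamma> (Carrier S)" "z \<in> hom C \<Gamma> (Carrier S)"
      show "meet_of C S (meet_of C S x y) z = meet_of C S x (meet_of C S y z)"
        by (rule mono[of _ \<Gamma>]) (simp_all add: xyz r P.meet_assoc)
      show "join_of C S (join_of C S x y) z = join_of C S x (join_of C S y z)"
        by (rule mono[of _ \<Gamma>]) (simp_all add: xyz r P.join_assoc)
      show "meet_of C S x (join_of C S y z) = join_of C S (meet_of C S x y) (meet_of C S x z)"
        by (rule mono[of _ \<Gamma>]) (simp_all add: xyz r P.meet_join_distrib)
    next
      fix x y
      assume xy: "x \<in> hom C \<Gamma> (Carrier S)" "y \<in> hom C \<Gamma> (Carrier S)"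
      show "meet_of C S x y = meet_of C S y x"
        by (rule mono[of _ \<Gamma>]) (simp_all add: xy r P.meet_commute)
      show "join_of C S x y = join_of C S y x"
        by (rule mono[of _ \<Gamma>]) (simp_all add: xy r P.join_commute)
      show "meet_of C S x (join_of C S x y) = x"
        by (rule mono[of _ \<Gamma>]) (simp_all add: xy r)
      show "join_of C S x (meet_of C S x y) = x"
        by (rule mono[of _ \<Gamma>]) (simp_all add: xy r)
    next
      fix x
      assume x: "x \<in> hom C \<Gamma> (Carrier S)"
      show "join_of C S x (bot_at C S \<Gamma>) = x"
        by (rule mono[of _ \<Gamma>]) (simp_all add: x r)
      show "meet_of C S x (top_at C S \<Gamma>) = x"
        by (rule mono[of _ \<Gamma>]) (simp_all add: x r)
    qed (simp_all add: r)
  qed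
  have SL: "bounded_distrib_lattice C S"
    unfolding bounded_distrib_lattice_def
    by (intro conjI ballI SO S(1-4);
      rule pts[THEN bounded_distrib_lattice_on.meet_assoc]
        pts[THEN bounded_distrib_lattice_on.join_assoc]
        pts[THEN bounded_distrib_lattice_on.meet_commute]
        pts[THEN bounded_distrib_lattice_on.join_commute]
        pts[THEN bounded_distrib_lattice_on.meet_join_absorb]
        pts[THEN bounded_distrib_lattice_on.join_meet_absorb]
        pts[THEN bounded_distrib_lattice_on.meet_join_distrib]
        pts[THEN bounded_distrib_lattice_on.join_bot]
        pts[THEN bounded_distrib_lattice_on.meet_top];
      assumption)
  have eh: "lattice_hom C S P e"
    using e eBot eTop emeet ejoin unfolding lattice_hom_def by blast
  note Ic = bdl_closed[OF I]
  have eS: "e \<odot> (Struct S \<odot> x) = Struct P \<odot> x" if "x \<in> hom C \<Gamma> (Carrier I)" for \<Gamma> x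
    using comp_assoc[OF that S(5) e] eStruct by simp
  have Sx: "Struct S \<odot> x \<in> hom C \<Gamma> (Carrier S)" if "x \<in> hom C \<Gamma> (Carrier I)" for \<Gamma> x
    using that S(5) comp_closed by blast
  \<comment> \<open>That \<open>Struct S\<close> is a homomorphism is reflected along
    \<open>e\<close> as well, from the same property of \<open>Struct P\<close>.\<close>
  have "Struct S \<odot> Bot I = Bot S"
    by (rule mono[OF Sx[OF Ic(2)] S(1)]) (use Ph Ic eS eBot in \<open>simp add: lattice_hom_def\<close>)
  moreover have "Struct S \<odot> Top I = Top S"
    by (rule mono[OF Sx[OF Ic(3)] S(2)]) (use Ph Ic eS eTop in \<open>simp add: lattice_hom_def\<close>)
  moreover have "Struct S \<odot> meet_of C I x y = meet_of C S (Struct S \<odot> x) (Struct S \<odot> y)"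
    "Struct S \<odot> join_of C I x y = join_of C S (Struct S \<odot> x) (Struct S \<odot> y)"
    if \<Gamma>: "\<Gamma> \<in> Obj C" and xy: "x \<in> hom C \<Gamma> (Carrier I)" "y \<in> hom C \<Gamma> (Carrier I)" for \<Gamma> x y
  proof -
    interpret I: bounded_distrib_lattice_on "hom C \<Gamma> (Carrier I)" "bot_at C I \<Gamma>" "top_at C I \<Gamma>"
      "meet_of C I" "join_of C I"
      by (rule points_lattice[OF I \<Gamma>])
    interpret S: bounded_distrib_lattice_on "hom C \<Gamma> (Carrier S)" "bot_at C S \<Gamma>" "top_at C S \<Gamma>"
      "meet_of C S" "join_of C S"
      by (rule points_lattice[OF SL \<Gamma>])
    show "Struct S \<odot> meet_of C I x y = meet_of C S (Struct S \<odot> x) (Struct S \<odot> y)"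
      by (rule mono[of _ \<Gamma>])
        (simp_all add: xy Sx[where \<Gamma> = \<Gamma>] eS[where \<Gamma> = \<Gamma>] emeet[OF Sx Sx, OF xy] lattice_hom_meet[OF Ph xy])
    show "Struct S \<odot> join_of C I x y = join_of C S (Struct S \<odot> x) (Struct S \<odot> y)"
      by (rule mono[of _ \<Gamma>])
        (simp_all add: xy Sx[where \<Gamma> = \<Gamma>] eS[where \<Gamma> = \<Gamma>] ejoin[OF Sx Sx, OF xy] lattice_hom_join[OF Ph xy])
  qed
  ultimately have "lattice_hom C I S (Struct S)"
    using S(5) unfolding lattice_hom_def by blast
  then show "I_algebra C I S"
    using SL by (simp add: I_algebra_def)
  show "I_algebra_hom C S P e"
    using eh eStruct by (simp add: I_algebra_hom_def)
qed

text \<open>The subobject of \<open>P\<close> on which \<open>f\<close> lies below \<open>g\<close>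
  is the equalizer of \<open>meet_of C A f g\<close> and \<open>f\<close>. Monotonicity of meet and
  join closes it under these operations, and \<open>f\<close> and \<open>g\<close> agree on the
  constants and on the image of \<open>I\<close>. The last three clauses say that the inequality
  holds on the subobject, that \<open>e\<close> is a monomorphism, and that every element satisfying
  the inequality factors through \<open>e\<close>.\<close>

lemma inserter_subalgebra:
  assumes I: "bounded_distrib_lattice C I" and P: "I_algebra C I P" and A: "I_algebra C I A"
    and f: "I_algebra_hom C P A f" and g: "I_algebra_hom C P A g"
  obtains S e where "I_algebra C I S" "I_algebra_hom C S P e"
    "meet_of C A (f \<odot> e) (g \<odot> e) = f \<odot> e"
    "\<And>\<Gamma> x y. \<lbrakk>x \<in> hom C \<Gamma> (Carrier S); y \<in> hom C \<Gamma> (Carrier S); e \<odot> x = e \<odot> y\<rbrakk> \<Longrightarrow> x = y"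
    "\<And>\<Gamma> x. \<lbrakk>x \<in> hom C \<Gamma> (Carrier P); meet_of C A (f \<odot> x) (g \<odot> x) = f \<odot> x\<rbrakk>
      \<Longrightarrow> \<exists>u \<in> hom C \<Gamma> (Carrier S). e \<odot> u = x"
proof -
  have PL: "bounded_distrib_lattice C P" and AL: "bounded_distrib_lattice C A"
    and Ps: "lattice_hom C I P (Struct P)" and As: "lattice_hom C I A (Struct A)"
    using P A by (auto simp: I_algebra_def)
  have fh: "lattice_hom C P A f" and gh: "lattice_hom C P A g"
    and fS: "f \<odot> Struct P = Struct A" and gS: "g \<odot> Struct P = Struct A"
    using f g by (auto simp: I_algebra_hom_def)
  note fc = lattice_hom_closed[OF fh] and gc = lattice_hom_closed[OF gh]
  note Pc = bdl_closed[OF PL]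
  define Q where "Q x \<longleftrightarrow> meet_of C A (f \<odot> x) (g \<odot> x) = f \<odot> x" for x
  have fx: "f \<odot> x \<in> hom C \<Gamma> (Carrier A)" "g \<odot> x \<in> hom C \<Gamma> (Carrier A)"
    if "x \<in> hom C \<Gamma> (Carrier P)" for \<Gamma> x
    using that fc gc comp_closed by auto
  have "meet_of C A f g \<in> hom C (Carrier P) (Carrier A)"
    using bounded_distrib_lattice_on.meet_closed[OF points_lattice[OF AL Pc(1)] fc gc] .
  from equalizers[OF this fc] obtain E e where e: "e \<in> hom C E (Carrier P)"
    and eq: "meet_of C A f g \<odot> e = f \<odot> e"
    and univ: "\<And>Z h. \<lbrakk>h \<in> hom C Z (Carrier P); meet_of C A f g \<odot> h = f \<odot> h\<rbrakk>
      \<Longrightarrow> \<exists>!u. u \<in> hom C Z E \<and> e \<odot> u = h"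
    by blast
  have Qe: "Q e"
    using eq meet_of_comp[OF AL fc gc e] by (simp add: Q_def)
  \<comment> \<open>The equalizer property restated for elements: \<open>Q x\<close> is the
    equalizing condition computed pointwise.\<close>
  have lift: "\<exists>!u. u \<in> hom C \<Gamma> E \<and> e \<odot> u = x" if "x \<in> hom C \<Gamma> (Carrier P)" "Q x" for \<Gamma> x
    using that univ[OF that(1)] meet_of_comp[OF AL fc gc that(1)] by (simp add: Q_def)
  have Q_comp: "Q (x \<odot> u)" if x: "x \<in> hom C \<Gamma> (Carrier P)" and "Q x" and u: "u \<in> hom C \<Delta> \<Gamma>"
    for \<Gamma> \<Delta> x u
    using \<open>Q x\<close> meet_of_comp[OF AL fx(1)[OF x] fx(2)[OF x] u]
      comp_assoc[OF u x fc] comp_assoc[OF u x gc]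
    by (simp add: Q_def)
  have mono: "x = y" if x: "x \<in> hom C \<Gamma> E" and y: "y \<in> hom C \<Gamma> E" and "e \<odot> x = e \<odot> y" for \<Gamma> x y
    using lift[OF comp_closed[OF x e] Q_comp[OF e Qe x]] that by auto
  have EO: "E \<in> Obj C"
    using e hom_dom by blast
  note p1 = proj1_closed[OF EO EO] and p2 = proj2_closed[OF EO EO]
  \<comment> \<open>\<open>x1\<close> and \<open>x2\<close> are the generic pair of elements of
    \<open>E\<close>, seen in \<open>P\<close>. Lifting their meet and join yields the operations on
    \<open>E\<close>.\<close>
  define x1 where "x1 = e \<odot> Proj1 C E E"
  define x2 where "x2 = e \<odot> Proj2 C E E"
  have x1: "x1 \<in> hom C (Prod C E E) (Carrier P)" "Q x1"
    and x2: "x2 \<in> hom C (Prod C E E) (Carrier P)" "Q x2"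
    using Q_comp[OF e Qe p1] Q_comp[OF e Qe p2] comp_closed[OF p1 e] comp_closed[OF p2 e]
    by (auto simp: x1_def x2_def)
  have EE: "Prod C E E \<in> Obj C"
    using prod_closed[OF EO EO] .
  interpret A2: bounded_distrib_lattice_on "hom C (Prod C E E) (Carrier A)"
    "bot_at C A (Prod C E E)" "top_at C A (Prod C E E)" "meet_of C A" "join_of C A"
    by (rule points_lattice[OF AL EE])
  interpret P2: bounded_distrib_lattice_on "hom C (Prod C E E) (Carrier P)"
    "bot_at C P (Prod C E E)" "top_at C P (Prod C E E)" "meet_of C P" "join_of C P"
    by (rule points_lattice[OF PL EE])
  interpret A1: bounded_distrib_lattice_on "hom C (One C) (Carrier A)"
    "bot_at C A (One C)" "top_at C A (One C)" "meet_of C A" "join_of C A"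
    by (rule points_lattice[OF AL one_closed])
  interpret AI: bounded_distrib_lattice_on "hom C (Carrier I) (Carrier A)"
    "bot_at C A (Carrier I)" "top_at C A (Carrier I)" "meet_of C A" "join_of C A"
    by (rule points_lattice[OF AL bdl_closed(1)[OF I]])
  have "f \<odot> Bot P = Bot A" "g \<odot> Bot P = Bot A" "f \<odot> Top P = Top A" "g \<odot> Top P = Top A"
    using fh gh by (auto simp: lattice_hom_def)
  \<comment> \<open>Where \<open>f\<close> and \<open>g\<close> take the same value,
    \<open>Q\<close> is just idempotence of the meet.\<close>
  then have "Q (Bot P)" "Q (Top P)"
    using A1.meet_idem[OF bdl_closed(2)[OF AL]] A1.meet_idem[OF bdl_closed(3)[OF AL]]
    by (auto simp: Q_def)
  moreover have "Q (Struct P)"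
    using AI.meet_idem[OF lattice_hom_closed[OF As]] by (simp add: Q_def fS gS)
  moreover have "Q (meet_of C P x1 x2)"
    using x1 x2 A2.meet_mono fx
    by (simp add: Q_def lattice_hom_meet[OF fh x1(1) x2(1)] lattice_hom_meet[OF gh x1(1) x2(1)])
  moreover have "Q (join_of C P x1 x2)"
    using x1 x2 A2.join_mono fx
    by (simp add: Q_def lattice_hom_join[OF fh x1(1) x2(1)] lattice_hom_join[OF gh x1(1) x2(1)])
  ultimately obtain b t m v s where
    b: "b \<in> hom C (One C) E" "e \<odot> b = Bot P" and
    t: "t \<in> hom C (One C) E" "e \<odot> t = Top P" and
    m: "m \<in> hom C (Prod C E E) E" "e \<odot> m = meet_of C P x1 x2" and
    v: "v \<in> hom C (Prod C E E) E" "e \<odot> v = join_of C P x1 x2" and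
    s: "s \<in> hom C (Carrier I) E" "e \<odot> s = Struct P"
    using lift Pc(2,3) P2.meet_closed[OF x1(1) x2(1)] P2.join_closed[OF x1(1) x2(1)]
      lattice_hom_closed[OF Ps] by metis
  define S where "S = \<lparr>Carrier = E, Bot = b, Top = t, Meet = m, Join = v, Struct = s\<rparr>"
  have "I_algebra C I S" "I_algebra_hom C S P e"
    by (rule subalgebra[OF I P];
        use e mono b t m v s in \<open>simp add: S_def x1_def x2_def\<close>)+
  moreover have "\<exists>u \<in> hom C \<Gamma> (Carrier S). e \<odot> u = x"
    if "x \<in> hom C \<Gamma> (Carrier P)" "meet_of C A (f \<odot> x) (g \<odot> x) = f \<odot> x" for \<Gamma> x
    using that lift[of x \<Gamma>] by (auto simp: Q_def S_def)
  ultimately show ?thesis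
    using that[of S e] Qe mono by (simp add: Q_def S_def)
qed

section \<open>The polynomial algebra and its evaluations at the two bounds\<close>

text \<open>The identity solves the same universal problem, with \<open>P\<close> itself as
  target.\<close>

lemma polynomial_endo_unique:
  assumes "polynomial_algebra C I A P \<iota> j"
    and "I_algebra_hom C P P h" "h \<odot> \<iota> = \<iota>" "h \<odot> j = j"
  shows "h = Ident C (Carrier P)"
proof -
  have P: "I_algebra C I P" and i: "I_algebra_hom C A P \<iota>" and j: "j \<in> hom C (One C) (Carrier P)"
    using assms(1) by (auto simp: polynomial_algebra_def)
  have "\<exists>!h. I_algebra_hom C P P h \<and> h \<odot> \<iota> = \<iota> \<and> h \<odot> j = j"
    using assms(1) P i j unfolding polynomial_algebra_def by blast
  moreover have "Ident C (Carrier P) \<odot> \<iota> = \<iota>" "Ident C (Carrier P) \<odot> j = j"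
    using i j ident_left lattice_hom_closed unfolding I_algebra_hom_def by blast+
  ultimately show ?thesis
    using I_algebra_hom_ident[OF P] assms by blast
qed

text \<open>Induction on polynomials, carried out by the universal property: the subalgebra where
  \<open>f\<close> lies below \<open>g\<close> contains the image of \<open>\<iota>\<close>, on
  which both agree, and \<open>j\<close>, which \<open>f\<close> sends to the bottom. Its inclusion
  therefore has a section, and the inequality spreads to all of \<open>P\<close>.\<close>

lemma polynomial_evaluations_ordered:
  assumes I: "bounded_distrib_lattice C I" and A: "I_algebra C I A"
    and poly: "polynomial_algebra C I A P \<iota> j"
    and f: "I_algebra_hom C P A f" "f \<odot> \<iota> = Ident C (Carrier A)" "f \<odot> j = Bot A"
    and g: "I_algebra_hom C P A g" "g \<odot> \<iota> = Ident C (Carrier A)"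
  shows "meet_of C A f g = f"
proof -
  have P: "I_algebra C I P" and i: "I_algebra_hom C A P \<iota>" and j: "j \<in> hom C (One C) (Carrier P)"
    using poly by (auto simp: polynomial_algebra_def)
  have AL: "bounded_distrib_lattice C A"
    using A by (auto simp: I_algebra_def)
  have ic: "\<iota> \<in> hom C (Carrier A) (Carrier P)" and fc: "f \<in> hom C (Carrier P) (Carrier A)"
    and gc: "g \<in> hom C (Carrier P) (Carrier A)"
    using i f g by (auto simp: I_algebra_hom_def lattice_hom_def)
  obtain S e where S: "I_algebra C I S" and e: "I_algebra_hom C S P e"
    and eq: "meet_of C A (f \<odot> e) (g \<odot> e) = f \<odot> e"
    and mono: "\<And>\<Gamma> x y. \<lbrakk>x \<in> hom C \<Gamma> (Carrier S); y \<in> hom C \<Gamma> (Carrier S); e \<odot> x = e \<odot> y\<rbrakk> \<Longrightarrow> x = y"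
    and lift: "\<And>\<Gamma> x. \<lbrakk>x \<in> hom C \<Gamma> (Carrier P); meet_of C A (f \<odot> x) (g \<odot> x) = f \<odot> x\<rbrakk>
      \<Longrightarrow> \<exists>u \<in> hom C \<Gamma> (Carrier S). e \<odot> u = x"
    using inserter_subalgebra[OF I P A f(1) g(1)] by blast
  have eh: "lattice_hom C S P e" and eS: "e \<odot> Struct S = Struct P"
    using e by (auto simp: I_algebra_hom_def)
  note ec = lattice_hom_closed[OF eh]
  have SL: "bounded_distrib_lattice C S" and Sc: "Struct S \<in> hom C (Carrier I) (Carrier S)"
    using S by (auto simp: I_algebra_def lattice_hom_def)
  have AO: "Carrier A \<in> Obj C" and Ac: "Struct A \<in> hom C (Carrier I) (Carrier A)"
    using A bdl_closed[OF AL] by (auto simp: I_algebra_def lattice_hom_def)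
  have "meet_of C A (f \<odot> \<iota>) (g \<odot> \<iota>) = f \<odot> \<iota>"
    using bounded_distrib_lattice_on.meet_idem[OF points_lattice[OF AL AO]] ident_closed[OF AO]
    by (simp add: f g)
  \<comment> \<open>\<open>k\<close> is \<open>\<iota>\<close> with its codomain restricted to
    \<open>S\<close>; below, \<open>l\<close> is \<open>j\<close> viewed as an element of
    \<open>S\<close>.\<close>
  from lift[OF ic this] obtain k where k: "k \<in> hom C (Carrier A) (Carrier S)" "e \<odot> k = \<iota>" by blast
  have "meet_of C A (f \<odot> j) (g \<odot> j) = f \<odot> j"
    using bounded_distrib_lattice_on.bot_meet[OF points_lattice[OF AL one_closed]] comp_closed[OF j gc]
    by (simp add: f bot_at_one[OF AL])
  from lift[OF j this] obtain l where l: "l \<in> hom C (One C) (Carrier S)" "e \<odot> l = j" by blast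
  have kx: "e \<odot> (k \<odot> x) = \<iota> \<odot> x" "k \<odot> x \<in> hom C \<Gamma> (Carrier S)"
    if "x \<in> hom C \<Gamma> (Carrier A)" for \<Gamma> x
    using comp_assoc[OF that k(1) ec] comp_closed[OF that k(1)] k(2) by auto
  have ih: "lattice_hom C A P \<iota>" and iS: "\<iota> \<odot> Struct A = Struct P"
    using i by (auto simp: I_algebra_hom_def)
  \<comment> \<open>Again everything is reflected along the monomorphism \<open>e\<close>, from
    \<open>\<iota>\<close> being a homomorphism.\<close>
  have "I_algebra_hom C A S k"
    unfolding I_algebra_hom_def lattice_hom_def
  proof (intro conjI ballI)
    show "k \<odot> Bot A = Bot S"
      by (rule mono) (use kx bdl_closed[OF AL] bdl_closed[OF SL] ih eh in \<open>auto simp: lattice_hom_def\<close>)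
    show "k \<odot> Top A = Top S"
      by (rule mono) (use kx bdl_closed[OF AL] bdl_closed[OF SL] ih eh in \<open>auto simp: lattice_hom_def\<close>)
    show "k \<odot> Struct A = Struct S"
      by (rule mono[OF kx(2)[OF Ac] Sc]) (simp add: kx(1)[OF Ac] eS iS)
  next
    fix \<Gamma> x y
    assume \<Gamma>: "\<Gamma> \<in> Obj C" and xy: "x \<in> hom C \<Gamma> (Carrier A)" "y \<in> hom C \<Gamma> (Carrier A)"
    interpret A: bounded_distrib_lattice_on "hom C \<Gamma> (Carrier A)" "bot_at C A \<Gamma>" "top_at C A \<Gamma>"
      "meet_of C A" "join_of C A"
      by (rule points_lattice[OF AL \<Gamma>])
    interpret S: bounded_distrib_lattice_on "hom C \<Gamma> (Carrier S)" "bot_at C S \<Gamma>" "top_at C S \<Gamma>"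
      "meet_of C S" "join_of C S"
      by (rule points_lattice[OF SL \<Gamma>])
    show "k \<odot> meet_of C A x y = meet_of C S (k \<odot> x) (k \<odot> y)"
      by (rule mono[of _ \<Gamma>])
        (simp_all add: kx[where \<Gamma> = \<Gamma>] xy lattice_hom_meet[OF ih xy] lattice_hom_meet[OF eh kx(2) kx(2), OF xy])
    show "k \<odot> join_of C A x y = join_of C S (k \<odot> x) (k \<odot> y)"
      by (rule mono[of _ \<Gamma>])
        (simp_all add: kx[where \<Gamma> = \<Gamma>] xy lattice_hom_join[OF ih xy] lattice_hom_join[OF eh kx(2) kx(2), OF xy])
  qed (rule k)
  then obtain s where s: "I_algebra_hom C P S s" "s \<odot> \<iota> = k" "s \<odot> j = l"
    using poly S l(1) unfolding polynomial_algebra_def by metis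
  have sc: "s \<in> hom C (Carrier P) (Carrier S)"
    using s by (simp add: I_algebra_hom_def lattice_hom_def)
  \<comment> \<open>The composite is an endomorphism of \<open>P\<close> that fixes
    \<open>\<iota>\<close> and \<open>j\<close>.\<close>
  have es: "e \<odot> s = Ident C (Carrier P)"
    using polynomial_endo_unique[OF poly I_algebra_hom_comp[OF P s(1) e]]
      comp_assoc[OF ic sc ec] comp_assoc[OF j sc ec] s k l by simp
  have r: "(h \<odot> e) \<odot> s = h" if "h \<in> hom C (Carrier P) (Carrier A)" for h
    using comp_assoc[OF sc ec that] ident_right[OF that] es by simp
  show ?thesis
    using meet_of_comp[OF AL comp_closed[OF ec fc] comp_closed[OF ec gc] sc] eq r fc gc by simp
qed

text \<open>\<open>r\<close> is the map
  \<open>p \<mapsto> \<iota> (f p) \<or> (j \<and> \<iota> (g p))\<close>, with the constant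
  \<open>j\<close> weakened to a context by composition with \<open>Bang\<close>. Preservation of
  joins is distributivity; preservation of meets rests on \<open>f\<close> lying below
  \<open>g\<close>.\<close>

lemma interpolation_hom:
  assumes I: "bounded_distrib_lattice C I" and A: "I_algebra C I A" and P: "I_algebra C I P"
    and i: "I_algebra_hom C A P \<iota>" and j: "j \<in> hom C (One C) (Carrier P)"
    and f: "I_algebra_hom C P A f" "f \<odot> \<iota> = Ident C (Carrier A)"
    and g: "I_algebra_hom C P A g" "g \<odot> \<iota> = Ident C (Carrier A)"
    and le: "meet_of C A f g = f"
  defines "r \<equiv> join_of C P (\<iota> \<odot> f) (meet_of C P (j \<odot> Bang C (Carrier P)) (\<iota> \<odot> g))"
  shows "I_algebra_hom C P P r" "r \<odot> \<iota> = \<iota>"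
    "\<And>\<Gamma> x. x \<in> hom C \<Gamma> (Carrier P) \<Longrightarrow>
      r \<odot> x = join_of C P (\<iota> \<odot> (f \<odot> x)) (meet_of C P (j \<odot> Bang C \<Gamma>) (\<iota> \<odot> (g \<odot> x)))"
proof -
  have AL: "bounded_distrib_lattice C A" and PL: "bounded_distrib_lattice C P"
    and Ps: "Struct P \<in> hom C (Carrier I) (Carrier P)"
    using A P by (auto simp: I_algebra_def lattice_hom_def)
  have ih: "lattice_hom C A P \<iota>" and fh: "lattice_hom C P A f" and gh: "lattice_hom C P A g"
    and S: "\<iota> \<odot> Struct A = Struct P" "f \<odot> Struct P = Struct A" "g \<odot> Struct P = Struct A"
    using i f g by (auto simp: I_algebra_hom_def)
  note ic = lattice_hom_closed[OF ih] and fc = lattice_hom_closed[OF fh]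
    and gc = lattice_hom_closed[OF gh]
  note Pc = bdl_closed[OF PL]
  have jc: "j \<odot> Bang C \<Gamma> \<in> hom C \<Gamma> (Carrier P)" if "\<Gamma> \<in> Obj C" for \<Gamma>
    using that j bang_closed comp_closed by blast
  have ifc: "\<iota> \<odot> f \<in> hom C (Carrier P) (Carrier P)" and igc: "\<iota> \<odot> g \<in> hom C (Carrier P) (Carrier P)"
    using comp_closed[OF fc ic] comp_closed[OF gc ic] by auto
  interpret PP: bounded_distrib_lattice_on "hom C (Carrier P) (Carrier P)" "bot_at C P (Carrier P)"
    "top_at C P (Carrier P)" "meet_of C P" "join_of C P"
    by (rule points_lattice[OF PL Pc(1)])
  have rc: "r \<in> hom C (Carrier P) (Carrier P)"
    using ifc igc jc Pc by (simp add: r_def)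
  show rx: "r \<odot> x = join_of C P (\<iota> \<odot> (f \<odot> x)) (meet_of C P (j \<odot> Bang C \<Gamma>) (\<iota> \<odot> (g \<odot> x)))"
    if x: "x \<in> hom C \<Gamma> (Carrier P)" for \<Gamma> x
  proof -
    have "(j \<odot> Bang C (Carrier P)) \<odot> x = j \<odot> Bang C \<Gamma>"
      using comp_assoc[OF x bang_closed[OF Pc(1)] j] bang_comp[OF x] by simp
    then show ?thesis
      using join_of_comp[OF PL ifc PP.meet_closed[OF jc[OF Pc(1)] igc] x]
        meet_of_comp[OF PL jc[OF Pc(1)] igc x] comp_assoc[OF x fc ic] comp_assoc[OF x gc ic]
      by (simp add: r_def)
  qed
  have fx: "f \<odot> x \<in> hom C \<Gamma> (Carrier A)" "g \<odot> x \<in> hom C \<Gamma> (Carrier A)"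
    "\<iota> \<odot> (f \<odot> x) \<in> hom C \<Gamma> (Carrier P)" "\<iota> \<odot> (g \<odot> x) \<in> hom C \<Gamma> (Carrier P)"
    if "x \<in> hom C \<Gamma> (Carrier P)" for \<Gamma> x
    using that ic fc gc comp_closed by blast+
  have lex: "meet_of C P (\<iota> \<odot> (f \<odot> x)) (\<iota> \<odot> (g \<odot> x)) = \<iota> \<odot> (f \<odot> x)"
    if x: "x \<in> hom C \<Gamma> (Carrier P)" for \<Gamma> x
    using lattice_hom_meet[OF ih fx(1,2)[OF x]] meet_of_comp[OF AL fc gc x] le by simp
  \<comment> \<open>Since \<open>f\<close> and \<open>g\<close> both retract \<open>\<iota>\<close>,
    the value at \<open>\<iota>\<close> is \<open>\<iota> \<or> (j \<and> \<iota>)\<close>, which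
    absorption reduces to \<open>\<iota>\<close>.\<close>
  show "r \<odot> \<iota> = \<iota>"
  proof -
    have AO: "Carrier A \<in> Obj C"
      using bdl_closed[OF AL] by simp
    interpret AP: bounded_distrib_lattice_on "hom C (Carrier A) (Carrier P)" "bot_at C P (Carrier A)"
      "top_at C P (Carrier A)" "meet_of C P" "join_of C P"
      by (rule points_lattice[OF PL AO])
    show ?thesis
      using rx[OF ic] f g ident_right[OF ic] AP.meet_commute[OF jc[OF AO] ic]
        AP.join_meet_absorb[OF ic jc[OF AO]] by simp
  qed
  \<comment> \<open>The structure map of \<open>P\<close> factors through \<open>\<iota>\<close>,
    which \<open>r\<close> fixes.\<close>
  then have rS: "r \<odot> Struct P = Struct P"
  proof -
    have "Struct A \<in> hom C (Carrier I) (Carrier A)"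
      using A by (simp add: I_algebra_def lattice_hom_def)
    then show ?thesis
      using comp_assoc[OF _ ic rc] S \<open>r \<odot> \<iota> = \<iota>\<close> by metis
  qed
  have "lattice_hom C P P r"
    unfolding lattice_hom_def
  proof (intro conjI ballI)
    have b: "f \<odot> Bot P = Bot A" "g \<odot> Bot P = Bot A" "\<iota> \<odot> Bot A = Bot P"
      "f \<odot> Top P = Top A" "g \<odot> Top P = Top A" "\<iota> \<odot> Top A = Top P"
      using ih fh gh by (auto simp: lattice_hom_def)
    have j1: "j \<odot> Bang C (One C) \<in> hom C (One C) (Carrier P)"
      by (rule jc[OF one_closed])
    interpret P1: bounded_distrib_lattice_on "hom C (One C) (Carrier P)" "bot_at C P (One C)"
      "top_at C P (One C)" "meet_of C P" "join_of C P"
      by (rule points_lattice[OF PL one_closed])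
    show "r \<odot> Bot P = Bot P"
      using rx[OF Pc(2)] P1.join_meet_absorb[OF P1.bot_closed j1] P1.meet_commute[OF P1.bot_closed j1]
      by (simp add: b bot_at_one[OF PL])
    show "r \<odot> Top P = Top P"
      using rx[OF Pc(3)] P1.top_join[OF j1] P1.meet_top[OF j1] by (simp add: b top_at_one[OF PL])
  next
    fix \<Gamma> x y
    assume \<Gamma>: "\<Gamma> \<in> Obj C" and x: "x \<in> hom C \<Gamma> (Carrier P)" and y: "y \<in> hom C \<Gamma> (Carrier P)"
    interpret P: bounded_distrib_lattice_on "hom C \<Gamma> (Carrier P)" "bot_at C P \<Gamma>"
      "top_at C P \<Gamma>" "meet_of C P" "join_of C P"
      by (rule points_lattice[OF PL \<Gamma>])
    note h = lattice_hom_op[OF fh x y] lattice_hom_op[OF gh x y]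
      lattice_hom_op[OF ih fx(1)[OF x] fx(1)[OF y]] lattice_hom_op[OF ih fx(2)[OF x] fx(2)[OF y]]
    show "r \<odot> meet_of C P x y = meet_of C P (r \<odot> x) (r \<odot> y)"
      using P.interpolation_meet[OF fx(3,4)[OF x] fx(3,4)[OF y] jc[OF \<Gamma>] lex[OF x] lex[OF y]]
      by (simp add: rx[OF x] rx[OF y] rx[OF P.meet_closed[OF x y]] h)
    show "r \<odot> join_of C P x y = join_of C P (r \<odot> x) (r \<odot> y)"
      using P.interpolation_join[OF fx(3,4)[OF x] fx(3,4)[OF y] jc[OF \<Gamma>]]
      by (simp add: rx[OF x] rx[OF y] rx[OF P.join_closed[OF x y]] h)
  qed (rule rc)
  with rS show "I_algebra_hom C P P r"
    by (simp add: I_algebra_hom_def)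
qed

text \<open>The interpolation map \<open>r\<close> turns out to be the identity, so an element of
  \<open>P\<close> is recovered from its two evaluations.\<close>

lemma polynomial_evaluations_jointly_injective:
  assumes I: "bounded_distrib_lattice C I" and A: "I_algebra C I A"
    and poly: "polynomial_algebra C I A P \<iota> j"
    and f: "I_algebra_hom C P A f" "f \<odot> \<iota> = Ident C (Carrier A)" "f \<odot> j = Bot A"
    and g: "I_algebra_hom C P A g" "g \<odot> \<iota> = Ident C (Carrier A)" "g \<odot> j = Top A"
    and x: "x \<in> hom C \<Gamma> (Carrier P)" and y: "y \<in> hom C \<Gamma> (Carrier P)"
    and eq: "f \<odot> x = f \<odot> y" "g \<odot> x = g \<odot> y"
  shows "x = y"
proof -
  have P: "I_algebra C I P" and i: "I_algebra_hom C A P \<iota>" and j: "j \<in> hom C (One C) (Carrier P)"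
    using poly by (auto simp: polynomial_algebra_def)
  have PL: "bounded_distrib_lattice C P"
    using P by (auto simp: I_algebra_def)
  have ih: "\<iota> \<odot> Bot A = Bot P" "\<iota> \<odot> Top A = Top P"
    using i by (auto simp: I_algebra_hom_def lattice_hom_def)
  define r where "r = join_of C P (\<iota> \<odot> f) (meet_of C P (j \<odot> Bang C (Carrier P)) (\<iota> \<odot> g))"
  note r = interpolation_hom[OF I A P i j f(1,2) g(1,2)
      polynomial_evaluations_ordered[OF I A poly f g(1,2)], folded r_def]
  interpret P1: bounded_distrib_lattice_on "hom C (One C) (Carrier P)" "bot_at C P (One C)"
    "top_at C P (One C)" "meet_of C P" "join_of C P"
    by (rule points_lattice[OF PL one_closed])
  \<comment> \<open>The values of \<open>f\<close> and \<open>g\<close> at \<open>j\<close> enter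
    here: the interpolant is bottom joined with the meet of \<open>j\<close> and top.\<close>
  have "r \<odot> j = j"
    using r(3)[OF j] P1.bot_join[OF j] P1.meet_top[OF j] ident_right[OF j]
    by (simp add: f g ih bang_one bot_at_one[OF PL] top_at_one[OF PL])
  then have "r = Ident C (Carrier P)"
    using polynomial_endo_unique[OF poly r(1,2)] by simp
  moreover have "r \<odot> x = r \<odot> y"
    using r(3)[OF x] r(3)[OF y] eq by simp
  ultimately show ?thesis
    using ident_left[OF x] ident_left[OF y] by simp
qed

section \<open>Transfer of the Phoa principle to the polynomial algebra\<close>

lemma polynomial_generalised_Phoa:
  assumes I: "bounded_distrib_lattice C I" and A: "I_algebra C I A"
    and poly: "polynomial_algebra C I A P \<iota> j" and Phoa: "generalised_Phoa C I A"
  shows "generalised_Phoa C I P"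
  unfolding generalised_Phoa_def
proof (intro ballI)
  fix \<Gamma> \<alpha> i
  assume \<Gamma>: "\<Gamma> \<in> Obj C" and \<alpha>: "\<alpha> \<in> hom C (Prod C \<Gamma> (Carrier I)) (Carrier P)"
    and i: "i \<in> hom C \<Gamma> (Carrier I)"
  have P: "I_algebra C I P"
    using poly by (auto simp: polynomial_algebra_def)
  have PL: "bounded_distrib_lattice C P" and AL: "bounded_distrib_lattice C A"
    and Ps: "Struct P \<in> hom C (Carrier I) (Carrier P)"
    using P A by (auto simp: I_algebra_def lattice_hom_def)
  interpret P: bounded_distrib_lattice_on "hom C \<Gamma> (Carrier P)" "bot_at C P \<Gamma>"
    "top_at C P \<Gamma>" "meet_of C P" "join_of C P"
    by (rule points_lattice[OF PL \<Gamma>])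
  interpret I: bounded_distrib_lattice_on "hom C \<Gamma> (Carrier I)" "bot_at C I \<Gamma>"
    "top_at C I \<Gamma>" "meet_of C I" "join_of C I"
    by (rule points_lattice[OF I \<Gamma>])
  \<comment> \<open>Evaluation of polynomials at \<open>b\<close>: the universal property with
    target \<open>A\<close> and the identity of \<open>A\<close> on coefficients.\<close>
  have ev: "\<exists>h. I_algebra_hom C P A h \<and> h \<odot> \<iota> = Ident C (Carrier A) \<and> h \<odot> j = b"
    if "b \<in> hom C (One C) (Carrier A)" for b
    using poly A I_algebra_hom_ident[OF A] that unfolding polynomial_algebra_def by blast
  obtain f where f: "I_algebra_hom C P A f" "f \<odot> \<iota> = Ident C (Carrier A)" "f \<odot> j = Bot A"
    using ev[OF bdl_closed(2)[OF AL]] by blast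
  obtain g where g: "I_algebra_hom C P A g" "g \<odot> \<iota> = Ident C (Carrier A)" "g \<odot> j = Top A"
    using ev[OF bdl_closed(3)[OF AL]] by blast
  have tc: "Tuple C (Ident C \<Gamma>) x \<in> hom C \<Gamma> (Prod C \<Gamma> (Carrier I))"
    if "x \<in> hom C \<Gamma> (Carrier I)" for x
    using tuple_closed[OF ident_closed[OF \<Gamma>] that] .
  have ac: "app C \<Gamma> \<alpha> x \<in> hom C \<Gamma> (Carrier P)" if "x \<in> hom C \<Gamma> (Carrier I)" for x
    using comp_closed[OF tc[OF that] \<alpha>] by (simp add: app_def)
  have sc: "Struct P \<odot> i \<in> hom C \<Gamma> (Carrier P)"
    using comp_closed[OF i Ps] .
  let ?rhs = "join_of C P (app C \<Gamma> \<alpha> (bot_at C I \<Gamma>))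
    (meet_of C P (Struct P \<odot> i) (app C \<Gamma> \<alpha> (top_at C I \<Gamma>)))"
  \<comment> \<open>The principle for \<open>A\<close> is applied to the function
    \<open>h \<odot> \<alpha>\<close>; as \<open>h\<close> preserves the operations and the
    structure map, the result is the image under \<open>h\<close> of the equation wanted in
    \<open>P\<close>.\<close>
  have "h \<odot> app C \<Gamma> \<alpha> i = h \<odot> ?rhs" if h: "I_algebra_hom C P A h" for h
  proof -
    have hh: "lattice_hom C P A h" and hS: "h \<odot> Struct P = Struct A"
      using h by (auto simp: I_algebra_hom_def)
    note hc = lattice_hom_closed[OF hh]
    have ha: "app C \<Gamma> (h \<odot> \<alpha>) x = h \<odot> app C \<Gamma> \<alpha> x" if "x \<in> hom C \<Gamma> (Carrier I)" for x
      using comp_assoc[OF tc[OF that] \<alpha> hc] by (simp add: app_def)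
    have "h \<odot> app C \<Gamma> \<alpha> i = join_of C A (h \<odot> app C \<Gamma> \<alpha> (bot_at C I \<Gamma>))
        (meet_of C A (Struct A \<odot> i) (h \<odot> app C \<Gamma> \<alpha> (top_at C I \<Gamma>)))"
      using Phoa \<Gamma> comp_closed[OF \<alpha> hc] i ha unfolding generalised_Phoa_def
      by (metis I.bot_closed I.top_closed)
    also have "Struct A \<odot> i = h \<odot> (Struct P \<odot> i)"
      using comp_assoc[OF i Ps hc] hS by simp
    finally show ?thesis
      using lattice_hom_join[OF hh ac[OF I.bot_closed] P.meet_closed[OF sc ac[OF I.top_closed]]]
        lattice_hom_meet[OF hh sc ac[OF I.top_closed]] by simp
  qed
  then show "app C \<Gamma> \<alpha> i = ?rhs"
    using polynomial_evaluations_jointly_injective[OF I A poly f g ac[OF i]] f(1) g(1) sc ac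
    by simp
qed

end

theorem theorem7p2:
  fixes C :: "('o, 'm, 'x) fp_cat_scheme"
    and I :: "('o, 'm) lattice_object"
    and A P :: "('o, 'm) algebra_object"
    and \<iota> j :: 'm
  assumes "finitely_complete_category C"
    and "bounded_distrib_lattice C I"
    and "I_algebra C I A"
    and "polynomial_algebra C I A P \<iota> j"
    and "generalised_Phoa C I A"
  shows "generalised_Phoa C I P"
  by (rule finitely_complete_category.polynomial_generalised_Phoa[OF assms])

end
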